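(* Let $X$ and $Z$ be Hausdorff topological vector spaces, let $C\subseteq Z$ be a convex and pointed cone with nonempty interior and let $K$ be a nonempty, convex subset of $X$. Consider a mapping $F:K\times K\times K\to Z$ satisfying: (i) for every $y\in K$, one of the following conditions is satisfied: (a) for every net $(x_\alpha)\subseteq K$ with $\lim x_\alpha=x\in K$: if $F(x_\alpha,y,y)\notin-\operatorname{int}C$ for all $\alpha$, then $F(x,y,y)\notin-\operatorname{int}C$; (b) the mapping $x\mapsto F(x,y,y)$ is $C$-upper semicontinuous on $K$; (c) for every $x\in K$ and every net $(x_\alpha)\subseteq K$ with $\lim x_\alpha=x$ there exists a net $(z_\alpha)\subseteq Z$ with $\lim z_\alpha=z$ such that $F(x_\alpha,y,y)-z_\alpha\in-C$ and $F(x,y,y)-z\in C$; (ii) for every $x\in K$, the mapping $y\mapsto F(x,y,y)$ is $C$-convex; (iii) for every $x\in K$, $F(x,x,x)\in(-C)\setminus(-\operatorname{int}C)$, and $F(x,x,y)\in-C$ for all $x,y\in K$, $x\neq y$; (iv) there exists a nonempty compact convex subset $K_0$ of $K$ with the property that for every $x\in K_0\setminus\operatorname{core}_K K_0$ there exists $y_0\in\operatorname{core}_K K_0$ such that $F(x,y_0,y_0)\in-C$; (v) $F$ is weakly explicitly $C$-quasiconvex with respect to the second variable; (vi) $F$ is weakly $C$-hemicontinuous with respect to the third variable. Then there exists an element $x_0\in K$ such that $F(x_0,y,x_0)\notin-\operatorname{int}C$ for all $y\in K$.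
   Context: All spaces are real. A cone $C$ satisfies $tc\in C$ for all $c\in C$, $t\ge 0$; it is convex if $C+C=C$ and pointed if $C\cap(-C)=\{0\}$ ($C$ is not assumed closed). $\operatorname{int}C$ is the interior of $C$. A map $f:K\to Z$ is $C$-upper semicontinuous at $x\in K$ if for any neighborhood $V$ of $f(x)$ there exists a neighborhood $U$ of $x$ such that $f(u)\in V-C$ for all $u\in U\cap K$; it is $C$-upper semicontinuous on $K$ if this holds at every $x\in K$. A map $f:K\to Z$ ($K$ convex) is $C$-convex if $tf(x)+(1-t)f(y)-f(tx+(1-t)y)\in C$ for all $x,y\in K$, $t\in[0,1]$. For convex sets $U\subseteq V\subseteq X$, the algebraic interior of $U$ relative to $V$ is $\operatorname{core}_V U=\{u\in U: U\cap\,]u,v]\ne\emptyset\ \text{for all } v\in V\}$, where $]u,v]=\{u+t(v-u): t\in\,]0,1]\}$. $F$ is weakly explicitly $C$-quasiconvex with respect to the second variable if for all $x,y,z\in K$ with $x\ne y$ and all $t\in\,]0,1[$ one has $F(x,(1-t)x+ty,z)-F(x,x,z)\in-\operatorname{int}C$ or $F(x,(1-t)x+ty,z)-F(x,y,z)\in-\operatorname{int}C$. $F$ is weakly $C$-hemicontinuous with respect to the third variable if for all $x,y\in K$ such that $F(x,y,(1-t)x+ty)\notin-\operatorname{int}C$ for all $t\in\,]0,1]$ one has $F(x,y,x)\notin-\operatorname{int}C$. *)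

theory Defs
  imports "HOL-Analysis.Analysis"
begin

class real_tvs = real_vector + topological_ab_group_add +
  assumes tendsto_scaleR_Pair:
    "LIM p (nhds c \<times>\<^sub>F nhds a). fst p *\<^sub>R snd p :> nhds (c *\<^sub>R a)"

instance real_normed_vector \<subseteq> real_tvs
proof
  fix c :: real and a :: 'a
  have "filterlim fst (nhds c) (nhds c \<times>\<^sub>F nhds a)"
    and "filterlim snd (nhds a) (nhds c \<times>\<^sub>F nhds a)"
    by (rule filterlim_fst filterlim_snd)+
  then show "LIM p (nhds c \<times>\<^sub>F nhds a). fst p *\<^sub>R snd p :> nhds (c *\<^sub>R a)"
    by (rule tendsto_scaleR)
qed

definition directed :: "'i set \<Rightarrow> ('i \<Rightarrow> 'i \<Rightarrow> bool) \<Rightarrow> bool" where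
  "directed I r \<longleftrightarrow> I \<noteq> {} \<and> (\<forall>i\<in>I. r i i)
     \<and> (\<forall>i\<in>I. \<forall>j\<in>I. \<forall>k\<in>I. r i j \<longrightarrow> r j k \<longrightarrow> r i k)
     \<and> (\<forall>i\<in>I. \<forall>j\<in>I. \<exists>k\<in>I. r i k \<and> r j k)"

definition tails :: "'i set \<Rightarrow> ('i \<Rightarrow> 'i \<Rightarrow> bool) \<Rightarrow> 'i filter" where
  "tails I r = (INF i\<in>I. principal {j \<in> I. r i j})"

(* A net is a function on a directed set (I, r); its convergence is tendsto along tails I r. *)
lemma eventually_tails:
  assumes "directed I r"
  shows "eventually P (tails I r) \<longleftrightarrow> (\<exists>i\<in>I. \<forall>j\<in>I. r i j \<longrightarrow> P j)"
  unfolding tails_def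
proof (subst eventually_INF_base)
  show "I \<noteq> {}"
    using assms by (simp add: directed_def)
  show "\<exists>k\<in>I. principal {j \<in> I. r k j} \<le> inf (principal {j \<in> I. r a j}) (principal {j \<in> I. r b j})"
    if ab: "a \<in> I" "b \<in> I" for a b
  proof -
    from assms ab obtain k where k: "k \<in> I" "r a k" "r b k"
      unfolding directed_def by blast
    have "r a j \<and> r b j" if "j \<in> I" "r k j" for j
      using assms ab k that unfolding directed_def by blast
    with k(1) show ?thesis by auto
  qed
qed (auto simp: eventually_principal)

(* Types cannot be quantified inside a hypothesis, so directed sets are taken inside one fixed
   index type. It has cardinality 2^(2^|X| + 2^|Z|): large enough to index the neighbourhood
   bases of X and Z, and (by a Loewenheim-Skolem argument) large enough that the net conditions
   below hold for all nets as soon as they hold for the nets indexed within this type. *)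
type_synonym ('x, 'z) net_index = "('x set + 'z set) set"

(* In the definitions below the sets -C and -int C are written as images under uminus,
   since "- C" denotes the complement and "V - C" the set difference. *)

definition C_usc_at :: "'z::real_tvs set \<Rightarrow> 'x::topological_space set \<Rightarrow> ('x \<Rightarrow> 'z) \<Rightarrow> 'x \<Rightarrow> bool" where
  "C_usc_at C K f x \<longleftrightarrow> (\<forall>V. open V \<and> f x \<in> V \<longrightarrow>
     (\<exists>U. open U \<and> x \<in> U \<and> (\<forall>u\<in>U \<inter> K. f u \<in> {v - c |v c. v \<in> V \<and> c \<in> C})))"

definition C_usc_on :: "'z::real_tvs set \<Rightarrow> 'x::topological_space set \<Rightarrow> ('x \<Rightarrow> 'z) \<Rightarrow> bool" where
  "C_usc_on C K f \<longleftrightarrow> (\<forall>x\<in>K. C_usc_at C K f x)"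

definition C_convex_on :: "'z::real_vector set \<Rightarrow> 'x::real_vector set \<Rightarrow> ('x \<Rightarrow> 'z) \<Rightarrow> bool" where
  "C_convex_on C K f \<longleftrightarrow> (\<forall>x\<in>K. \<forall>y\<in>K. \<forall>t\<in>{0..1::real}.
     t *\<^sub>R f x + (1 - t) *\<^sub>R f y - f (t *\<^sub>R x + (1 - t) *\<^sub>R y) \<in> C)"

definition core_rel :: "'x::real_vector set \<Rightarrow> 'x set \<Rightarrow> 'x set" where
  "core_rel V U = {u \<in> U. \<forall>v\<in>V. U \<inter> {u + t *\<^sub>R (v - u) |t::real. t \<in> {0<..1}} \<noteq> {}}"

definition weakly_explicitly_C_quasiconvex ::
    "'z::real_tvs set \<Rightarrow> 'x::real_vector set \<Rightarrow> ('x \<Rightarrow> 'x \<Rightarrow> 'x \<Rightarrow> 'z) \<Rightarrow> bool" where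
  "weakly_explicitly_C_quasiconvex C K F \<longleftrightarrow>
     (\<forall>x\<in>K. \<forall>y\<in>K. \<forall>z\<in>K. x \<noteq> y \<longrightarrow> (\<forall>t\<in>{0<..<1::real}.
        F x ((1 - t) *\<^sub>R x + t *\<^sub>R y) z - F x x z \<in> uminus ` interior C \<or>
        F x ((1 - t) *\<^sub>R x + t *\<^sub>R y) z - F x y z \<in> uminus ` interior C))"

definition weakly_C_hemicontinuous ::
    "'z::real_tvs set \<Rightarrow> 'x::real_vector set \<Rightarrow> ('x \<Rightarrow> 'x \<Rightarrow> 'x \<Rightarrow> 'z) \<Rightarrow> bool" where
  "weakly_C_hemicontinuous C K F \<longleftrightarrow>
     (\<forall>x\<in>K. \<forall>y\<in>K.
        (\<forall>t\<in>{0<..1::real}. F x y ((1 - t) *\<^sub>R x + t *\<^sub>R y) \<notin> uminus ` interior C) \<longrightarrow>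
        F x y x \<notin> uminus ` interior C)"

(* The three alternative conditions of hypothesis (i), for a map g (there g x = F x y y). *)

definition net_closed_cond ::
    "'z::real_tvs set \<Rightarrow> 'x::real_tvs set \<Rightarrow> ('x \<Rightarrow> 'z) \<Rightarrow> bool" where
  "net_closed_cond C K g \<longleftrightarrow>
     (\<forall>(I :: ('x, 'z) net_index set) r \<xi> x.
        directed I r \<and> (\<forall>i\<in>I. \<xi> i \<in> K) \<and> x \<in> K \<and> (\<xi> \<longlongrightarrow> x) (tails I r) \<longrightarrow>
        (\<forall>i\<in>I. g (\<xi> i) \<notin> uminus ` interior C) \<longrightarrow> g x \<notin> uminus ` interior C)"

definition net_majorant_cond ::
    "'z::real_tvs set \<Rightarrow> 'x::real_tvs set \<Rightarrow> ('x \<Rightarrow> 'z) \<Rightarrow> bool" where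
  "net_majorant_cond C K g \<longleftrightarrow>
     (\<forall>(I :: ('x, 'z) net_index set) r \<xi> x.
        directed I r \<and> (\<forall>i\<in>I. \<xi> i \<in> K) \<and> x \<in> K \<and> (\<xi> \<longlongrightarrow> x) (tails I r) \<longrightarrow>
        (\<exists>\<zeta> z. (\<zeta> \<longlongrightarrow> z) (tails I r) \<and>
           (\<forall>i\<in>I. g (\<xi> i) - \<zeta> i \<in> uminus ` C) \<and> g x - z \<in> C))"

end

theory Submission
  imports Defs
begin

text \<open>
  Write \<open>N = - interior C\<close>; a value in \<open>N\<close> is one that is strictly negative for the
  cone order. Adding an element of \<open>- C\<close> or multiplying by a positive number does not leave
  \<open>N\<close>, so a \<open>C\<close>-convex map that lies in \<open>N\<close> at one end of a segment and in \<open>- C\<close> at the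
  other lies in \<open>N\<close> at every point of the segment except perhaps the latter end
  (\<open>C_convex_on_neg_interior\<close>). This is used for the covering property below, and again to pass
  from the compact set to all of \<open>K\<close>.

  On the compact convex set \<open>K0\<close> put \<open>G y = {x \<in> K0. F x y y \<notin> N}\<close>. Each of the three
  alternative conditions on \<open>x \<mapsto> F x y y\<close> makes \<open>G y\<close> closed (\<open>net_closed_imp_closed\<close>).
  If \<open>x\<close> is a convex combination of points \<open>y\<close> with \<open>x \<notin> G y\<close>, then convexity forces
  \<open>F x x x \<in> N\<close>, against the condition on the diagonal. Hence the Knaster--Kuratowski--Mazurkiewicz
  principle (\<open>KKM\<close>) gives \<open>x0 \<in> K0\<close> with \<open>F x0 y y \<notin> N\<close> for all \<open>y \<in> K0\<close>.

  This property extends to all \<open>y \<in> K\<close>: there is a point \<open>p\<close> in the core of \<open>K0\<close> relative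
  to \<open>K\<close> with \<open>F x0 p p \<in> - C\<close>, namely \<open>x0\<close> itself or the point that the coercivity condition
  supplies. The segment from \<open>p\<close> to \<open>y\<close> meets \<open>K0\<close> beyond \<open>p\<close>, and \<open>F x0 y y \<in> N\<close> would
  push the value at that meeting point into \<open>N\<close> too.

  Last comes a Minty-type argument. For \<open>y \<noteq> x0\<close> and \<open>z = (1 - t) x0 + t y\<close> with \<open>0 < t < 1\<close>, explicit
  quasiconvexity says that \<open>F x0 z z\<close> is strictly below \<open>F x0 x0 z\<close> or below \<open>F x0 y z\<close>.
  The former is impossible, as \<open>F x0 x0 z \<in> - C\<close> and \<open>F x0 z z \<notin> N\<close>; the latter excludes
  \<open>F x0 y z \<in> N\<close>. Letting \<open>z\<close> move to \<open>x0\<close>, hemicontinuity yields \<open>F x0 y x0 \<notin> N\<close>.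

  The KKM principle holds in every topological vector space because it is a statement about finitely
  many points at a time, that is, about a closed cover of a simplex. It is derived here from
  Kuhn's combinatorial lemma, a form of Sperner's lemma on the grid of a cube whose dimension
  is a natural number and not a type; the simplex is parametrized by the cube through stick breaking.
\<close>

section \<open>Continuity of scalar multiplication\<close>

lemma tendsto_scaleR_tvs:
  fixes g :: "'a \<Rightarrow> 'x::real_tvs"
  assumes "(f \<longlongrightarrow> c) A" and "(g \<longlongrightarrow> a) A"
  shows "((\<lambda>u. f u *\<^sub>R g u) \<longlongrightarrow> c *\<^sub>R a) A"
  using filterlim_compose[OF tendsto_scaleR_Pair filterlim_Pair[OF assms]] by simp

lemma continuous_on_scaleR_tvs:
  fixes g :: "'a::topological_space \<Rightarrow> 'x::real_tvs"
  assumes "continuous_on S f" and "continuous_on S g"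
  shows "continuous_on S (\<lambda>u. f u *\<^sub>R g u)"
  using assms unfolding continuous_on_def by (blast intro: tendsto_scaleR_tvs)

section \<open>The lemma of Knaster, Kuratowski and Mazurkiewicz\<close>

text \<open>
  The simplex lemma of Kuhn in terms of a single label in \<open>{..n}\<close> per grid point instead of a
  zero-one label per coordinate. The two boundary conditions say when a label is forbidden on a
  face of the cube; a small grid simplex then carries all \<open>n + 1\<close> labels, and its vertices
  differ by at most one grid step in each coordinate.
\<close>

lemma kuhn_complete_simplex:
  fixes l :: "(nat \<Rightarrow> nat) \<Rightarrow> nat"
  assumes "0 < p"
    and l_le: "\<And>v. (\<forall>j. v j \<le> p) \<Longrightarrow> l v \<le> n"
    and l_zero: "\<And>v j. (\<forall>j. v j \<le> p) \<Longrightarrow> j < n \<Longrightarrow> v j = 0 \<Longrightarrow> l v \<noteq> j"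
    and l_full: "\<And>v j. (\<forall>j. v j \<le> p) \<Longrightarrow> j < n \<Longrightarrow> v j = p \<Longrightarrow> l v \<le> j"
  obtains v where "\<And>k j. k \<le> n \<Longrightarrow> v k j \<le> p" and "\<And>k. k \<le> n \<Longrightarrow> l (v k) = k"
    and "\<And>k j. k \<le> n \<Longrightarrow> \<bar>int (v k j) - int (v 0 j)\<bar> \<le> 1"
proof -
  \<comment> \<open>Kuhn's reduced label is the first coordinate with label one, so coordinate \<open>l v\<close> gets a one and
    all earlier ones a zero; later ones only have to respect the faces of the cube.\<close>
  define lab where "lab v j = (if j < l v then 0 else if j = l v \<or> v j = p then 1 else 0 :: nat)"
    for v j
  have red: "reduced n (lab v) = l v" if "\<forall>j. v j \<le> p" for v
    using l_le[OF that] by (intro reduced_labelling_unique) (auto simp: lab_def)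
  have "odd (card {s. ksimplex p n s \<and> (reduced n \<circ> lab) ` s = {..n}})"
  proof (rule kuhn_combinatorial[OF \<open>0 < p\<close>])
    show "\<forall>v j. (\<forall>j. v j \<le> p) \<and> j < n \<and> v j = 0 \<longrightarrow> lab v j = 0"
      using l_zero \<open>0 < p\<close> by (auto simp: lab_def)
    show "\<forall>v j. (\<forall>j. v j \<le> p) \<and> j < n \<and> v j = p \<longrightarrow> lab v j = 1"
    proof (intro allI impI, elim conjE)
      fix v :: "nat \<Rightarrow> nat" and j assume "\<forall>j. v j \<le> p" "j < n" "v j = p"
      then show "lab v j = 1"
        using l_full[of v j] by (simp add: lab_def)
    qed
  qed
  then have "{s. ksimplex p n s \<and> (reduced n \<circ> lab) ` s = {..n}} \<noteq> {}"
    by (rule odd_card_imp_not_empty)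
  then obtain s b u where ks: "kuhn_simplex p n b u s" and rl: "(reduced n \<circ> lab) ` s = {..n}"
    by (auto elim: ksimplex.cases)
  interpret kuhn_simplex p n b u s by fact
  have "\<exists>w\<in>s. reduced n (lab w) = k" if "k \<le> n" for k
    using rl that by (metis (no_types, lifting) atMost_iff comp_apply imageE)
  then obtain v where v: "\<And>k. k \<le> n \<Longrightarrow> v k \<in> s" "\<And>k. k \<le> n \<Longrightarrow> reduced n (lab (v k)) = k"
    by metis
  have le: "w j \<le> p" if "w \<in> s" for w j
    using that s_space out_eq_p[of w j] by (cases "j < n") auto
  have near: "b j \<le> w j \<and> w j \<le> Suc (b j)" if "w \<in> s" for w j
    using that by (auto simp: s_eq enum_def)
  show thesis
  proof
    show "v k j \<le> p" if "k \<le> n" for k j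
      using le v that by blast
    show "l (v k) = k" if "k \<le> n" for k
      using red[of "v k"] le v that by metis
    show "\<bar>int (v k j) - int (v 0 j)\<bar> \<le> 1" if "k \<le> n" for k j
      using near[OF v(1)[OF that], of j] near[OF v(1)[of 0], of j] by auto
  qed
qed

text \<open>
  Stick breaking: from what the first \<open>k\<close> cuts have left of a stick of length one, piece \<open>k\<close>
  takes the fraction \<open>s k\<close>, and piece \<open>n\<close> takes all of the rest. This maps the cube to the
  barycentric coordinates of the simplex with vertices \<open>0, ..., n\<close>. Its use is that piece
  \<open>k < n\<close> vanishes on the face \<open>s k = 0\<close>, and all pieces after \<open>j\<close> vanish on the face
  \<open>s j = 1\<close>: these are exactly the boundary conditions for Kuhn labels.
\<close>

definition stick :: "nat \<Rightarrow> (nat \<Rightarrow> real) \<Rightarrow> nat \<Rightarrow> real" where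
  "stick n s k = (if k < n then s k else 1) * (\<Prod>j<k. 1 - s j)"

lemma sum_stick: "(\<Sum>k\<le>n. stick n s k) = 1"
proof -
  \<comment> \<open>The first \<open>m\<close> pieces and the remainder make up the whole stick.\<close>
  have "(\<Sum>k<m. s k * (\<Prod>j<k. 1 - s j)) = 1 - (\<Prod>j<m. 1 - s j)" for m
    by (induction m) (auto simp: algebra_simps)
  moreover have "(\<Sum>k<n. stick n s k) = (\<Sum>k<n. s k * (\<Prod>j<k. 1 - s j))"
    by (intro sum.cong) (auto simp: stick_def)
  ultimately show ?thesis
    by (simp add: lessThan_Suc_atMost[symmetric] stick_def)
qed

lemma stick_nonneg: "(\<And>j. s j \<in> {0..1}) \<Longrightarrow> 0 \<le> stick n s k"
  unfolding stick_def by (intro mult_nonneg_nonneg prod_nonneg) auto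

lemma continuous_on_stick: "continuous_on A (\<lambda>s. stick n s k)"
proof -
  have "continuous_on A (\<lambda>s::nat \<Rightarrow> real. s j)" for j
    by (rule continuous_on_product_then_coordinatewise[OF continuous_on_id])
  then show ?thesis
    unfolding stick_def by (cases "k < n") (auto intro!: continuous_intros)
qed

lemma compact_unit_cube: "compact {s :: nat \<Rightarrow> real. \<forall>j. s j \<in> {0..1}}"
proof -
  have "compactin (product_topology (\<lambda>_. euclidean) (UNIV :: nat set)) (PiE UNIV (\<lambda>_. {0..1::real}))"
    by (simp add: compactin_PiE)
  moreover have "PiE (UNIV :: nat set) (\<lambda>_. {0..1::real}) = {s. \<forall>j. s j \<in> {0..1}}"
    by (auto simp: PiE_UNIV_domain)
  ultimately show ?thesis
    by (simp add: euclidean_product_topology)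
qed

lemma tendsto_fun_iff:
  fixes f :: "'a \<Rightarrow> 'i \<Rightarrow> 'b::topological_space"
  shows "(f \<longlongrightarrow> l) A \<longleftrightarrow> (\<forall>j. ((\<lambda>u. f u j) \<longlongrightarrow> l j) A)"
  using limitin_componentwise[of "\<lambda>_. euclidean" UNIV f l A]
  by (simp add: euclidean_product_topology)

text \<open>
  The KKM principle for \<open>n + 1\<close> points, which may coincide or be affinely dependent, because it
  is proved in the parameter cube. Label a grid point of mesh \<open>1 / (m + 1)\<close> by an index \<open>k\<close> with
  positive weight whose set \<open>G k\<close> contains its image. Kuhn's lemma gives points \<open>w m k\<close> of label
  \<open>k\<close>, one for each \<open>k \<le> n\<close>, that approach each other as \<open>m\<close> grows; the image of a limit
  point lies in every \<open>G k\<close>. The cube lives in \<open>nat \<Rightarrow> real\<close>, where it is compact and, the product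
  topology being metrizable, sequentially compact.
\<close>

lemma KKM_simplex:
  fixes y :: "nat \<Rightarrow> 'x::real_tvs" and G :: "nat \<Rightarrow> 'x set"
  assumes G_closed: "\<And>k. k \<le> n \<Longrightarrow> closed (G k)"
    and cover: "\<And>t. (\<And>k. 0 \<le> t k) \<Longrightarrow> (\<Sum>k\<le>n. t k) = 1
      \<Longrightarrow> \<exists>k\<le>n. 0 < t k \<and> (\<Sum>k\<le>n. t k *\<^sub>R y k) \<in> G k"
  shows "\<exists>x \<in> convex hull (y ` {..n}). \<forall>k\<le>n. x \<in> G k"
proof -
  define Q where "Q = {s :: nat \<Rightarrow> real. \<forall>j. s j \<in> {0..1}}"
  define \<Phi> where "\<Phi> s = (\<Sum>k\<le>n. stick n s k *\<^sub>R y k)" for s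
  have \<Phi>_cont: "continuous_on UNIV \<Phi>"
    unfolding \<Phi>_def
    by (intro continuous_on_sum continuous_on_scaleR_tvs continuous_on_stick continuous_on_const)
  have \<Phi>_label: "\<exists>k\<le>n. 0 < stick n s k \<and> \<Phi> s \<in> G k" if "s \<in> Q" for s
    unfolding \<Phi>_def using that by (intro cover sum_stick stick_nonneg) (auto simp: Q_def)
  have "\<exists>w. (\<forall>k\<le>n. w k \<in> Q \<and> \<Phi> (w k) \<in> G k \<and> (\<forall>j. \<bar>w k j - w 0 j\<bar> \<le> 1 / Suc m))" for m
  proof -
    define sc where "sc v j = real (v j) / real (Suc m)" for v :: "nat \<Rightarrow> nat" and j :: nat
    define l where "l v = (SOME k. k \<le> n \<and> 0 < stick n (sc v) k \<and> \<Phi> (sc v) \<in> G k)" for v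
    have sc_Q: "sc v \<in> Q" if "\<forall>j. v j \<le> Suc m" for v
      using that by (auto simp: Q_def sc_def divide_le_eq_1 simp del: of_nat_Suc)
    have l: "l v \<le> n \<and> 0 < stick n (sc v) (l v) \<and> \<Phi> (sc v) \<in> G (l v)" if "\<forall>j. v j \<le> Suc m" for v
      using someI_ex[OF \<Phi>_label[OF sc_Q[OF that]]] unfolding l_def by simp
    obtain v where v: "\<And>k j. k \<le> n \<Longrightarrow> v k j \<le> Suc m" "\<And>k. k \<le> n \<Longrightarrow> l (v k) = k"
        "\<And>k j. k \<le> n \<Longrightarrow> \<bar>int (v k j) - int (v 0 j)\<bar> \<le> 1"
    proof (rule kuhn_complete_simplex[of "Suc m" l n])
      fix v :: "nat \<Rightarrow> nat" and j assume v: "\<forall>j. v j \<le> Suc m" and "j < n"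
      { assume "v j = 0"
        then have "stick n (sc v) j = 0"
          using \<open>j < n\<close> by (simp add: stick_def sc_def)
        then show "l v \<noteq> j"
          using l[OF v] by auto }
      { assume "v j = Suc m"
        then have "1 - sc v j = 0"
          by (simp add: sc_def)
        then have "stick n (sc v) k = 0" if "j < k" for k
          using that by (auto simp: stick_def intro: bexI[of _ j])
        then show "l v \<le> j"
          using l[OF v] by (metis less_irrefl not_le) }
    qed (use l in auto)
    have "\<bar>sc (v k) j - sc (v 0) j\<bar> \<le> 1 / Suc m" if "k \<le> n" for k j
    proof -
      have "\<bar>real (v k j) - real (v 0 j)\<bar> \<le> 1"
        using v(3)[OF that, of j] by linarith
      then show ?thesis
        unfolding sc_def by (simp add: diff_divide_distrib[symmetric] divide_right_mono del: of_nat_Suc)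
    qed
    moreover have "sc (v k) \<in> Q \<and> \<Phi> (sc (v k)) \<in> G k" if "k \<le> n" for k
      using that sc_Q[of "v k"] l[of "v k"] v by auto
    ultimately show ?thesis
      by (intro exI[of _ "\<lambda>k. sc (v k)"]) auto
  qed
  then obtain w where w: "\<And>m k. k \<le> n \<Longrightarrow> w m k \<in> Q" "\<And>m k. k \<le> n \<Longrightarrow> \<Phi> (w m k) \<in> G k"
      "\<And>m k j. k \<le> n \<Longrightarrow> \<bar>w m k j - w m 0 j\<bar> \<le> 1 / Suc m"
    by metis
  have "seq_compact Q"
    using compact_unit_cube unfolding Q_def by (rule compact_imp_seq_compact)
  then obtain s r where s: "s \<in> Q" and r: "strict_mono r" and lim0: "(\<lambda>m. w (r m) 0) \<longlonglongrightarrow> s"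
    using seq_compactE[of Q "\<lambda>m. w m 0"] w(1)[of 0] unfolding comp_def by auto
  have "\<Phi> s \<in> G k" if k: "k \<le> n" for k
  proof -
    have "(\<lambda>m. w (r m) k j) \<longlonglongrightarrow> s j" for j
    proof -
      have "(\<lambda>m. w (r m) 0 j) \<longlonglongrightarrow> s j"
        using lim0 by (simp add: tendsto_fun_iff)
      moreover have "(\<lambda>m. w (r m) k j - w (r m) 0 j) \<longlonglongrightarrow> 0"
      proof (rule Lim_null_comparison)
        show "\<forall>\<^sub>F m in sequentially. norm (w (r m) k j - w (r m) 0 j) \<le> 1 / Suc (r m)"
          using w(3)[OF k] by simp
        show "(\<lambda>m. 1 / real (Suc (r m))) \<longlonglongrightarrow> 0"
          using LIMSEQ_subseq_LIMSEQ[OF LIMSEQ_Suc[OF lim_1_over_n] r] by (simp add: comp_def)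
      qed
      ultimately show ?thesis
        by (rule Lim_transform)
    qed
    then have "(\<lambda>m. w (r m) k) \<longlonglongrightarrow> s"
      by (simp add: tendsto_fun_iff)
    then have "(\<lambda>m. \<Phi> (w (r m) k)) \<longlonglongrightarrow> \<Phi> s"
      using continuous_on_tendsto_compose[OF \<Phi>_cont] by simp
    with G_closed[OF k] w(2)[OF k] show ?thesis
      using Lim_in_closed_set[of "G k" "\<lambda>m. \<Phi> (w (r m) k)" sequentially] by auto
  qed
  moreover have "\<Phi> s \<in> convex hull (y ` {..n})"
    unfolding \<Phi>_def
  proof (rule convex_sum)
    show "0 \<le> stick n s k" for k
      using s by (intro stick_nonneg) (auto simp: Q_def)
  qed (auto simp: sum_stick intro: hull_inc)
  ultimately show ?thesis
    by blast
qed

text \<open>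
  The general form follows by compactness: a finite set of points is numbered, and the weights of
  a convex combination are restricted to those that are positive, whose points carry a member
  of the cover.
\<close>

theorem KKM:
  fixes S :: "'x::real_tvs set" and G :: "'x \<Rightarrow> 'x set"
  assumes S: "compact S" "convex S" "S \<noteq> {}"
    and G_closed: "\<And>a. a \<in> S \<Longrightarrow> closed (G a)"
    and hull: "\<And>A. finite A \<Longrightarrow> A \<subseteq> S \<Longrightarrow> convex hull A \<subseteq> (\<Union>a\<in>A. G a)"
  shows "\<exists>x\<in>S. \<forall>a\<in>S. x \<in> G a"
proof -
  have fip: "S \<inter> (\<Inter>a\<in>A. G a) \<noteq> {}" if A: "finite A" "A \<subseteq> S" for A
  proof (cases "A = {}")
    case True
    then show ?thesis using S by simp
  next
    case False
    then obtain m where "card A = Suc m"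
      using A(1) by (metis card_eq_0_iff not0_implies_Suc)
    obtain y where "bij_betw y {0..<card A} A"
      using ex_bij_betw_nat_finite[OF A(1)] by blast
    then have y: "A = y ` {..m}"
      using \<open>card A = Suc m\<close> unfolding bij_betw_def
      by (simp add: atLeast0LessThan lessThan_Suc_atMost)
    have "\<exists>x \<in> convex hull (y ` {..m}). \<forall>k\<le>m. x \<in> G (y k)"
    proof (rule KKM_simplex)
      show "closed (G (y k))" if "k \<le> m" for k
        using that G_closed A(2) y by auto
      fix t :: "nat \<Rightarrow> real" assume t: "\<And>k. 0 \<le> t k" "(\<Sum>k\<le>m. t k) = 1"
      define P where "P = {k. k \<le> m \<and> 0 < t k}"
      have zero: "t k = 0" if "k \<in> {..m} - P" for k
        using t(1)[of k] that by (auto simp: P_def)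
      have fin: "finite P" by (simp add: P_def)
      have one: "(\<Sum>k\<in>P. t k) = 1"
      proof -
        have "(\<Sum>k\<le>m. t k) = (\<Sum>k\<in>P. t k)"
          using zero by (intro sum.mono_neutral_right) (auto simp: P_def)
        with t(2) show ?thesis by simp
      qed
      have eq: "(\<Sum>k\<le>m. t k *\<^sub>R y k) = (\<Sum>k\<in>P. t k *\<^sub>R y k)"
        using zero by (intro sum.mono_neutral_right) (auto simp: P_def)
      have "(\<Sum>k\<in>P. t k *\<^sub>R y k) \<in> convex hull (y ` P)"
        using fin t(1) one by (intro convex_sum) (auto intro: hull_inc)
      moreover have "convex hull (y ` P) \<subseteq> (\<Union>a\<in>y ` P. G a)"
        using A y fin by (intro hull) (auto simp: P_def)
      ultimately show "\<exists>k\<le>m. 0 < t k \<and> (\<Sum>k\<le>m. t k *\<^sub>R y k) \<in> G (y k)"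
        unfolding eq by (auto simp: P_def)
    qed
    moreover have "convex hull A \<subseteq> S"
      using A(2) S(2) by (rule hull_minimal)
    ultimately show ?thesis
      unfolding y by blast
  qed
  have "S \<inter> (\<Inter>a\<in>S. G a) \<noteq> {}"
    by (rule compact_imp_fip_image[OF S(1) G_closed fip])
  then show ?thesis
    by blast
qed

section \<open>Cones and their interiors\<close>

text \<open>
  The translate of \<open>interior C\<close> by \<open>c\<close> is open and contained in \<open>C + C\<close>.
\<close>

lemma interior_cone_add:
  fixes C :: "'z::real_tvs set"
  assumes sum: "{a + b |a b. a \<in> C \<and> b \<in> C} = C" and "a \<in> interior C" and "c \<in> C"
  shows "a + c \<in> interior C"
proof (rule interiorI)
  show "open ((\<lambda>z. z - c) -` interior C)"
    by (intro open_vimage open_interior continuous_intros)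
  show "(\<lambda>z. z - c) -` interior C \<subseteq> C"
  proof
    fix z assume "z \<in> (\<lambda>z. z - c) -` interior C"
    then have "z - c \<in> C"
      using interior_subset by auto
    then have "(z - c) + c \<in> C"
      using sum \<open>c \<in> C\<close> by blast
    then show "z \<in> C" by simp
  qed
qed (use assms in simp)

lemma interior_cone_scaleR:
  fixes C :: "'z::real_tvs set"
  assumes "cone C" and "a \<in> interior C" and "0 < t"
  shows "t *\<^sub>R a \<in> interior C"
proof (rule interiorI)
  show "open ((\<lambda>z. (1 / t) *\<^sub>R z) -` interior C)"
    by (intro open_vimage open_interior continuous_on_scaleR_tvs continuous_intros)
  show "(\<lambda>z. (1 / t) *\<^sub>R z) -` interior C \<subseteq> C"
  proof
    fix z assume "z \<in> (\<lambda>z. (1 / t) *\<^sub>R z) -` interior C"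
    then have "(1 / t) *\<^sub>R z \<in> C"
      using interior_subset by auto
    then have "t *\<^sub>R ((1 / t) *\<^sub>R z) \<in> C"
      using \<open>cone C\<close> \<open>0 < t\<close> unfolding cone_def by (metis less_imp_le)
    then show "z \<in> C" using \<open>0 < t\<close> by simp
  qed
qed (use assms in simp)

lemma mem_uminus_image: "(a::'z::ab_group_add) \<in> uminus ` S \<longleftrightarrow> - a \<in> S"
  by force

lemma open_uminus_interior: "open (uminus ` interior (C :: 'z::real_tvs set))"
proof -
  have "uminus ` interior C = uminus -` interior C"
    by (auto simp: mem_uminus_image)
  then show ?thesis
    by (auto intro!: open_vimage continuous_intros)
qed

lemma neg_interior_add:
  fixes C :: "'z::real_tvs set"
  assumes "{a + b |a b. a \<in> C \<and> b \<in> C} = C" and "a \<in> uminus ` interior C" and "b \<in> uminus ` C"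
  shows "a + b \<in> uminus ` interior C"
  using interior_cone_add[OF assms(1), of "- a" "- b"] assms(2,3)
  by (simp add: mem_uminus_image add.commute)

text \<open>
  The value at the intermediate point is a convex combination of the values at the ends minus an
  element of \<open>C\<close>, and the term from \<open>x\<close> alone, having positive weight, brings the sum into the
  open cone.
\<close>

lemma C_convex_on_neg_interior:
  fixes C :: "'z::real_tvs set"
  assumes cone: "cone C" and sum: "{a + b |a b. a \<in> C \<and> b \<in> C} = C"
    and f: "C_convex_on C K f" and "x \<in> K" "y \<in> K"
    and fx: "f x \<in> uminus ` interior C" and fy: "f y \<in> uminus ` C" and t: "0 < t" "t \<le> 1"
  shows "f (t *\<^sub>R x + (1 - t) *\<^sub>R y) \<in> uminus ` interior C"
proof -
  let ?u = "t *\<^sub>R x + (1 - t) *\<^sub>R y"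
  have "t *\<^sub>R f x \<in> uminus ` interior C"
    using interior_cone_scaleR[OF cone, of "- f x" t] fx t by (simp add: mem_uminus_image)
  moreover have "(1 - t) *\<^sub>R f y \<in> uminus ` C"
    using mem_cone[OF cone, of "- f y" "1 - t"] fy t by (simp add: mem_uminus_image)
  ultimately have "t *\<^sub>R f x + (1 - t) *\<^sub>R f y \<in> uminus ` interior C"
    by (rule neg_interior_add[OF sum])
  moreover have "f ?u - (t *\<^sub>R f x + (1 - t) *\<^sub>R f y) \<in> uminus ` C"
    using f \<open>x \<in> K\<close> \<open>y \<in> K\<close> t unfolding C_convex_on_def mem_uminus_image by simp
  ultimately have "(t *\<^sub>R f x + (1 - t) *\<^sub>R f y) + (f ?u - (t *\<^sub>R f x + (1 - t) *\<^sub>R f y))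
      \<in> uminus ` interior C"
    by (rule neg_interior_add[OF sum])
  then show ?thesis by simp
qed

lemma convex_neg_interior_preimage:
  fixes C :: "'z::real_tvs set"
  assumes cone: "cone C" and sum: "{a + b |a b. a \<in> C \<and> b \<in> C} = C"
    and f: "C_convex_on C K f" and K: "convex K"
  shows "convex {y \<in> K. f y \<in> uminus ` interior C}"
proof (rule convexI)
  fix a b and s t :: real
  assume a: "a \<in> {y \<in> K. f y \<in> uminus ` interior C}"
    and b: "b \<in> {y \<in> K. f y \<in> uminus ` interior C}"
    and st: "0 \<le> s" "0 \<le> t" "s + t = 1"
  have t: "t = 1 - s"
    using st by simp
  have "f b \<in> uminus ` C"
    using b interior_subset[of C] by blast
  then have "f (s *\<^sub>R a + t *\<^sub>R b) \<in> uminus ` interior C" if "s \<noteq> 0"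
    unfolding t using a b st that by (intro C_convex_on_neg_interior[OF cone sum f]) simp_all
  moreover have "f (s *\<^sub>R a + t *\<^sub>R b) \<in> uminus ` interior C" if "s = 0"
    using b st that by simp
  moreover have "s *\<^sub>R a + t *\<^sub>R b \<in> K"
    using convexD[OF K _ _ st] a b by simp
  ultimately show "s *\<^sub>R a + t *\<^sub>R b \<in> {y \<in> K. f y \<in> uminus ` interior C}"
    by blast
qed

section \<open>Closedness in the first variable\<close>

lemma eventually_tails_imp_ex:
  assumes dir: "directed I r" and "\<forall>\<^sub>F i in tails I r. P i"
  shows "\<exists>i\<in>I. P i"
proof -
  obtain i where "i \<in> I" "\<forall>j\<in>I. r i j \<longrightarrow> P j"
    using assms eventually_tails[OF dir] by blast
  moreover have "r i i"
    using dir \<open>i \<in> I\<close> unfolding directed_def by blast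
  ultimately show ?thesis by blast
qed

text \<open>
  The next two lemmas reduce the alternatives for the first variable to closedness under nets.
  Upper semicontinuity is applied with \<open>- interior C\<close> itself as the neighbourhood of \<open>g x\<close>;
  it absorbs the subtraction of \<open>C\<close>.
\<close>

lemma C_usc_imp_net_closed:
  fixes C :: "'z::real_tvs set" and K :: "'x::real_tvs set"
  assumes sum: "{a + b |a b. a \<in> C \<and> b \<in> C} = C" and usc: "C_usc_on C K g"
  shows "net_closed_cond C K g"
  unfolding net_closed_cond_def
proof (intro allI impI notI, elim conjE)
  fix I :: "('x, 'z) net_index set" and r \<xi> x
  assume dir: "directed I r" and \<xi>: "\<forall>i\<in>I. \<xi> i \<in> K" and "x \<in> K"
    and lim: "(\<xi> \<longlongrightarrow> x) (tails I r)" and out: "\<forall>i\<in>I. g (\<xi> i) \<notin> uminus ` interior C"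
    and gx: "g x \<in> uminus ` interior C"
  have "C_usc_at C K g x"
    using usc \<open>x \<in> K\<close> unfolding C_usc_on_def by blast
  then obtain U where U: "open U" "x \<in> U"
      "\<forall>u\<in>U \<inter> K. g u \<in> {v - c |v c. v \<in> uminus ` interior C \<and> c \<in> C}"
    using gx open_uminus_interior[of C]
    unfolding C_usc_at_def by (elim allE[of _ "uminus ` interior C"]) blast
  have "\<forall>\<^sub>F i in tails I r. \<xi> i \<in> U"
    using lim U(1,2) by (rule topological_tendstoD)
  then obtain i where "i \<in> I" "\<xi> i \<in> U"
    using eventually_tails_imp_ex[OF dir] by blast
  then obtain v c where "g (\<xi> i) = v - c" "v \<in> uminus ` interior C" "c \<in> C"
    using U(3) \<xi> by blast
  then have "g (\<xi> i) \<in> uminus ` interior C"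
    using neg_interior_add[OF sum, of v "- c"] by (simp add: mem_uminus_image)
  with out \<open>i \<in> I\<close> show False by blast
qed

text \<open>
  If \<open>g x\<close> were in \<open>- interior C\<close>, so would be the limit \<open>z\<close> of the majorants, as it lies below
  \<open>g x\<close>. Then the majorants would eventually enter this open set and pull \<open>g (\<xi> i)\<close> with them.
\<close>

lemma net_majorant_imp_net_closed:
  fixes C :: "'z::real_tvs set" and K :: "'x::real_tvs set"
  assumes sum: "{a + b |a b. a \<in> C \<and> b \<in> C} = C" and maj: "net_majorant_cond C K g"
  shows "net_closed_cond C K g"
  unfolding net_closed_cond_def
proof (intro allI impI notI, elim conjE)
  fix I :: "('x, 'z) net_index set" and r \<xi> x
  assume dir: "directed I r" and \<xi>: "\<forall>i\<in>I. \<xi> i \<in> K" and "x \<in> K"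
    and lim: "(\<xi> \<longlongrightarrow> x) (tails I r)" and out: "\<forall>i\<in>I. g (\<xi> i) \<notin> uminus ` interior C"
    and gx: "g x \<in> uminus ` interior C"
  obtain \<zeta> z where \<zeta>: "(\<zeta> \<longlongrightarrow> z) (tails I r)" "\<forall>i\<in>I. g (\<xi> i) - \<zeta> i \<in> uminus ` C"
      and z: "g x - z \<in> C"
    using maj dir \<xi> \<open>x \<in> K\<close> lim unfolding net_majorant_cond_def by blast
  have "z \<in> uminus ` interior C"
    using neg_interior_add[OF sum gx, of "z - g x"] z by (simp add: mem_uminus_image)
  with \<zeta>(1) have "\<forall>\<^sub>F i in tails I r. \<zeta> i \<in> uminus ` interior C"
    by (rule topological_tendstoD[OF _ open_uminus_interior])
  then obtain i where "i \<in> I" "\<zeta> i \<in> uminus ` interior C"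
    using eventually_tails_imp_ex[OF dir] by blast
  then have "\<zeta> i + (g (\<xi> i) - \<zeta> i) \<in> uminus ` interior C"
    using \<zeta>(2) by (intro neg_interior_add[OF sum]) blast+
  then have "g (\<xi> i) \<in> uminus ` interior C"
    by simp
  with out \<open>i \<in> I\<close> show False by blast
qed

text \<open>
  A point of the closure is the limit of a net indexed by its open neighbourhoods. The prescribed
  index type holds this directed set when the neighbourhood \<open>U\<close> is coded as \<open>{Inl U}\<close>.
  Compactness in a Hausdorff space keeps the limit inside \<open>S\<close>, hence inside \<open>K\<close>, where the
  condition on nets applies.
\<close>

lemma net_closed_imp_closed:
  fixes C :: "'z::real_tvs set" and K :: "'x::{real_tvs, t2_space} set"
  assumes closed: "net_closed_cond C K g" and S: "compact S" "S \<subseteq> K"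
  shows "closed {x \<in> S. g x \<notin> uminus ` interior C}" (is "closed ?G")
proof -
  have "x \<in> ?G" if x: "x \<in> closure ?G" for x
  proof -
    have "closure ?G \<subseteq> S"
      using S(1) by (intro closure_minimal compact_imp_closed) auto
    with x have "x \<in> S" by blast
    define I :: "('x, 'z) net_index set" where "I = {{Inl U} |U. open U \<and> x \<in> U}"
    define nb where "nb i = (THE U. i = {Inl U})" for i :: "('x, 'z) net_index"
    have nb [simp]: "nb {Inl U} = U" for U
      by (simp add: nb_def)
    define r where "r i j \<longleftrightarrow> nb j \<subseteq> nb i" for i j
    define \<xi> where "\<xi> i = (SOME u. u \<in> nb i \<inter> ?G)" for i
    have \<xi>: "\<xi> i \<in> nb i \<inter> ?G" if i: "i \<in> I" for i
    proof -
      obtain U where "i = {Inl U}" "open U" "x \<in> U"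
        using i unfolding I_def by blast
      then have "nb i \<inter> ?G \<noteq> {}"
        using x open_Int_closure_eq_empty[of U ?G] by auto
      then show ?thesis
        unfolding \<xi>_def by (rule some_in_eq[THEN iffD2])
    qed
    have dir: "directed I r"
      unfolding directed_def
    proof (intro conjI ballI)
      show "I \<noteq> {}"
        by (auto simp: I_def)
      fix i j assume "i \<in> I" "j \<in> I"
      then obtain U V where "i = {Inl U}" "j = {Inl V}" "open U" "open V" "x \<in> U" "x \<in> V"
        by (auto simp: I_def)
      then show "\<exists>k\<in>I. r i k \<and> r j k"
        by (intro bexI[of _ "{Inl (U \<inter> V)}"]) (auto simp: I_def r_def)
    qed (auto simp: r_def)
    have "(\<xi> \<longlongrightarrow> x) (tails I r)"
    proof (rule topological_tendstoI)
      fix U assume "open U" "x \<in> U"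
      then show "\<forall>\<^sub>F i in tails I r. \<xi> i \<in> U"
        unfolding eventually_tails[OF dir] using \<xi>
        by (intro bexI[of _ "{Inl U}"]) (auto simp: I_def r_def)
    qed
    moreover have "\<forall>i\<in>I. \<xi> i \<in> K" "\<forall>i\<in>I. g (\<xi> i) \<notin> uminus ` interior C" "x \<in> K"
      using \<xi> S(2) \<open>x \<in> S\<close> by blast+
    ultimately have "g x \<notin> uminus ` interior C"
      using closed dir unfolding net_closed_cond_def by blast
    with \<open>x \<in> S\<close> show ?thesis by blast
  qed
  then have "closure ?G \<subseteq> ?G"
    by (rule subsetI)
  then show ?thesis
    by (simp only: closure_subset_eq)
qed

section \<open>Existence of a solution\<close>

theorem theorem3p12:
  fixes C :: "'z::{real_tvs, t2_space} set"
    and K :: "'x::{real_tvs, t2_space} set"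
    and F :: "'x \<Rightarrow> 'x \<Rightarrow> 'x \<Rightarrow> 'z"
  assumes C_cone: "cone C"
    and C_convex: "{a + b |a b. a \<in> C \<and> b \<in> C} = C"
    and C_pointed: "C \<inter> uminus ` C = {0}"
    and C_int: "interior C \<noteq> {}"
    and K_ne: "K \<noteq> {}"
    and K_convex: "convex K"
    and i: "\<forall>y\<in>K. net_closed_cond C K (\<lambda>x. F x y y)
                 \<or> C_usc_on C K (\<lambda>x. F x y y)
                 \<or> net_majorant_cond C K (\<lambda>x. F x y y)"
    and ii: "\<forall>x\<in>K. C_convex_on C K (\<lambda>y. F x y y)"
    and iii_diag: "\<forall>x\<in>K. F x x x \<in> uminus ` C - uminus ` interior C"
    and iii_off: "\<forall>x\<in>K. \<forall>y\<in>K. x \<noteq> y \<longrightarrow> F x x y \<in> uminus ` C"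
    and iv: "\<exists>K0. K0 \<noteq> {} \<and> compact K0 \<and> convex K0 \<and> K0 \<subseteq> K \<and>
               (\<forall>x\<in>K0 - core_rel K K0. \<exists>y0\<in>core_rel K K0. F x y0 y0 \<in> uminus ` C)"
    and v: "weakly_explicitly_C_quasiconvex C K F"
    and vi: "weakly_C_hemicontinuous C K F"
  shows "\<exists>x0\<in>K. \<forall>y\<in>K. F x0 y x0 \<notin> uminus ` interior C"
proof -
  let ?N = "uminus ` interior C"
  note neg_add = neg_interior_add[OF C_convex]
  have N_subset: "?N \<subseteq> uminus ` C"
    using interior_subset by blast
  obtain K0 where K0: "K0 \<noteq> {}" "compact K0" "convex K0" "K0 \<subseteq> K"
    and boundary: "\<forall>x\<in>K0 - core_rel K K0. \<exists>y0\<in>core_rel K K0. F x y0 y0 \<in> uminus ` C"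
    using iv by (elim exE conjE)

  have "\<exists>x\<in>K0. \<forall>y\<in>K0. x \<in> {x \<in> K0. F x y y \<notin> ?N}"
  proof (rule KKM[OF K0(2,3,1)])
    fix y assume "y \<in> K0"
    then have "net_closed_cond C K (\<lambda>x. F x y y)"
      using i K0(4) C_usc_imp_net_closed[OF C_convex] net_majorant_imp_net_closed[OF C_convex]
      by blast
    then show "closed {x \<in> K0. F x y y \<notin> ?N}"
      using K0(2,4) by (rule net_closed_imp_closed)
  next
    fix A assume A: "A \<subseteq> K0"
    show "convex hull A \<subseteq> (\<Union>y\<in>A. {x \<in> K0. F x y y \<notin> ?N})"
    proof
      fix x assume x: "x \<in> convex hull A"
      with A K0(3) have "x \<in> K0"
        using hull_minimal[of A K0 convex] by (meson subsetD)
      then have "x \<in> K" using K0(4) by blast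
      have "convex {y \<in> K. F x y y \<in> ?N}"
        using ii \<open>x \<in> K\<close> K_convex by (intro convex_neg_interior_preimage[OF C_cone C_convex]) auto
      then have "x \<in> {y \<in> K. F x y y \<in> ?N}" if "A \<subseteq> {y \<in> K. F x y y \<in> ?N}"
        using that x hull_minimal[of A "{y \<in> K. F x y y \<in> ?N}" convex] by (meson subsetD)
      then have "\<not> A \<subseteq> {y \<in> K. F x y y \<in> ?N}"
        using iii_diag \<open>x \<in> K\<close> by blast
      then show "x \<in> (\<Union>y\<in>A. {x \<in> K0. F x y y \<notin> ?N})"
        using A K0(4) \<open>x \<in> K0\<close> by blast
    qed
  qed
  then obtain x0 where "x0 \<in> K0" and on_K0: "\<And>y. y \<in> K0 \<Longrightarrow> F x0 y y \<notin> ?N"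
    by blast
  then have "x0 \<in> K" using K0(4) by blast

  \<comment> \<open>The coercivity condition provides a base point in the core from which segments can be followed
    out of \<open>K0\<close>.\<close>
  obtain p where p: "p \<in> core_rel K K0" "F x0 p p \<in> uminus ` C"
  proof (cases "x0 \<in> core_rel K K0")
    case True
    moreover have "F x0 x0 x0 \<in> uminus ` C"
      using iii_diag \<open>x0 \<in> K\<close> by blast
    ultimately show thesis ..
  next
    case False
    with boundary \<open>x0 \<in> K0\<close> that show thesis by blast
  qed
  have on_K: "F x0 y y \<notin> ?N" if "y \<in> K" for y
  proof
    assume y: "F x0 y y \<in> ?N"
    obtain t where t: "0 < t" "t \<le> 1" "p + t *\<^sub>R (y - p) \<in> K0"
    proof -
      have "K0 \<inter> {p + t *\<^sub>R (y - p) |t. t \<in> {0<..1}} \<noteq> {}"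
        using p(1) \<open>y \<in> K\<close> unfolding core_rel_def by blast
      then show thesis
        using that by auto
    qed
    let ?z = "t *\<^sub>R y + (1 - t) *\<^sub>R p"
    have "p + t *\<^sub>R (y - p) = ?z"
      by (simp add: algebra_simps)
    then have "F x0 ?z ?z \<notin> ?N"
      using t(3) on_K0 by simp
    moreover have "p \<in> K"
      using p(1) K0(4) unfolding core_rel_def by blast
    have "C_convex_on C K (\<lambda>y. F x0 y y)"
      using ii \<open>x0 \<in> K\<close> by blast
    from C_convex_on_neg_interior[OF C_cone C_convex this \<open>y \<in> K\<close> \<open>p \<in> K\<close> y p(2) t(1,2)]
    have "F x0 ?z ?z \<in> ?N" .
    ultimately show False ..
  qed

  \<comment> \<open>At \<open>t = 1\<close> quasiconvexity says nothing, but there the claim is the diagonal one for \<open>y\<close>.\<close>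
  have "F x0 y x0 \<notin> ?N" if "y \<in> K" for y
  proof (cases "y = x0")
    case True
    then show ?thesis using iii_diag \<open>x0 \<in> K\<close> by blast
  next
    case False
    have "F x0 y ((1 - t) *\<^sub>R x0 + t *\<^sub>R y) \<notin> ?N" if t: "t \<in> {0<..1}" for t
    proof (cases "t = 1")
      case True
      then show ?thesis using on_K[OF \<open>y \<in> K\<close>] by simp
    next
      case False
      let ?y = "(1 - t) *\<^sub>R x0 + t *\<^sub>R y"
      have "?y \<in> K"
        using convexD[OF K_convex \<open>x0 \<in> K\<close> \<open>y \<in> K\<close>, of "1 - t" t] t by simp
      have "?y - x0 = t *\<^sub>R (y - x0)"
        by (simp add: algebra_simps)
      then have "?y \<noteq> x0"
        using \<open>y \<noteq> x0\<close> t by auto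
      have out: "F x0 ?y ?y \<notin> ?N"
        by (rule on_K) fact
      have "F x0 ?y ?y - F x0 x0 ?y \<in> ?N \<or> F x0 ?y ?y - F x0 y ?y \<in> ?N"
      proof -
        have "t \<in> {0<..<1}"
          using t \<open>t \<noteq> 1\<close> by simp
        then show ?thesis
          using v \<open>x0 \<in> K\<close> \<open>y \<in> K\<close> \<open>?y \<in> K\<close> \<open>y \<noteq> x0\<close>[symmetric]
          unfolding weakly_explicitly_C_quasiconvex_def by blast
      qed
      moreover have "F x0 x0 ?y \<in> uminus ` C"
        using iii_off \<open>x0 \<in> K\<close> \<open>?y \<in> K\<close> \<open>?y \<noteq> x0\<close> by metis
      then have "F x0 ?y ?y - F x0 x0 ?y \<notin> ?N"
        using neg_add[of "F x0 ?y ?y - F x0 x0 ?y" "F x0 x0 ?y"] out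
        unfolding diff_add_cancel by blast
      ultimately have "F x0 ?y ?y - F x0 y ?y \<in> ?N"
        by blast
      then show ?thesis
        using neg_add[of "F x0 ?y ?y - F x0 y ?y" "F x0 y ?y"] out N_subset
        unfolding diff_add_cancel by blast
    qed
    then show ?thesis
      using vi \<open>x0 \<in> K\<close> \<open>y \<in> K\<close> unfolding weakly_C_hemicontinuous_def by blast
  qed
  with \<open>x0 \<in> K\<close> show ?thesis
    by blast
qed

end
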